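(* For each $n\in\{1,\dots,M\}$ and each initial condition $z$ at time $t_{n-1}$, let $\mathcal{F}(t_n,t_{n-1},z)$ be the exact solution at time $t_n$ of $\dot u=f(u)$ started from $z$ at time $t_{n-1}$, and let $\mathcal{G}(t_n,t_{n-1},z)$ be its approximation by a coarse integrator. Assume that the local truncation error $\tau(t_n,z):=\mathcal{F}(t_n,t_{n-1},z)-\mathcal{G}(t_n,t_{n-1},z)$ satisfies, for all $n$ and all $y,z$, $$\|\tau(t_n,z)\|\le\alpha,\qquad \|\tau(t_n,y)-\tau(t_n,z)\|\le\beta\|y-z\|,$$ where $\alpha,\beta>0$ are constants, and that for some constant $\eta\in(0,1)$, for all $n$ and all $y,z$, $$\max\left\{\|\mathcal{F}(t_n,t_{n-1},y)-\mathcal{F}(t_n,t_{n-1},z)\|,\ \|\mathcal{G}(t_n,t_{n-1},y)-\mathcal{G}(t_n,t_{n-1},z)\|\right\}\le\eta\|y-z\|.$$ Then for all $k\ge0$ and $0\le n\le M$ the parareal iterates satisfy $\|U_n^k-u(t_n)\|\le B_n^k$, where $$B_n^k:=\begin{cases}0, & n\le k,\\[2pt] \alpha\beta^k\displaystyle\sum_{i=0}^{n-k-1}\binom{k+i}{k}\eta^i, & n>k.\end{cases}$$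
   Context: Consider the initial value problem $\dot u(t)=f(u(t))$, $t\in[0,T]$, $u(0)=u_0$ (in $\mathbb{R}^m$, assumed well posed), and a partition $0=t_0<t_1<\dots<t_M=T$. The parareal iterates $U_n^k$ ($k\ge0$, $0\le n\le M$) are defined by $U_0^k=u_0$ for all $k$, $U_n^0=\mathcal{G}(t_n,t_{n-1},U_{n-1}^0)$ for $1\le n\le M$, and $$U_n^{k+1}=\mathcal{F}(t_n,t_{n-1},U_{n-1}^k)+\mathcal{G}(t_n,t_{n-1},U_{n-1}^{k+1})-\mathcal{G}(t_n,t_{n-1},U_{n-1}^k),\qquad 1\le n\le M.$$ $\|\cdot\|$ is the Euclidean norm. *)

theory Defs
  imports "HOL-Analysis.Analysis"
begin

(* Derivatives are taken within {a..b}, hence one-sided at the two endpoints. *)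
definition solves_ivp_on ::
    "('v::real_normed_vector \<Rightarrow> 'v) \<Rightarrow> real \<Rightarrow> real \<Rightarrow> 'v \<Rightarrow> (real \<Rightarrow> 'v) \<Rightarrow> bool"
  where
  "solves_ivp_on f a b z v \<longleftrightarrow>
     v a = z \<and> (\<forall>s\<in>{a..b}. (v has_vector_derivative f (v s)) (at s within {a..b}))"

(* Existence and uniqueness. Solutions are total functions on the reals, so uniqueness
   can only be demanded on {a..b}. *)
definition well_posed_ivp_on ::
    "('v::real_normed_vector \<Rightarrow> 'v) \<Rightarrow> real \<Rightarrow> real \<Rightarrow> 'v \<Rightarrow> bool"
  where
  "well_posed_ivp_on f a b z \<longleftrightarrow>
     (\<exists>v. solves_ivp_on f a b z v) \<and>
     (\<forall>v w. solves_ivp_on f a b z v \<longrightarrow> solves_ivp_on f a b z w \<longrightarrow>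
        (\<forall>s\<in>{a..b}. v s = w s))"

(* exact_propagator f b a z is the value at time b of the solution started from z at time a;
   the later time comes first. It is unspecified unless well_posed_ivp_on f a b z holds. *)
definition exact_propagator ::
    "('v::real_normed_vector \<Rightarrow> 'v) \<Rightarrow> real \<Rightarrow> real \<Rightarrow> 'v \<Rightarrow> 'v"
  where
  "exact_propagator f b a z = (THE x. \<exists>v. solves_ivp_on f a b z v \<and> v b = x)"

definition is_time_partition :: "real \<Rightarrow> nat \<Rightarrow> (nat \<Rightarrow> real) \<Rightarrow> bool"
  where
  "is_time_partition T M t \<longleftrightarrow>
     0 < M \<and> t 0 = 0 \<and> t M = T \<and> (\<forall>n<M. t n < t (Suc n))"

(* tau(t_n, z), meaningful for n > 0 *)
definition local_truncation_error ::
    "(real \<Rightarrow> real \<Rightarrow> 'v \<Rightarrow> 'v::real_normed_vector) \<Rightarrow> (real \<Rightarrow> real \<Rightarrow> 'v \<Rightarrow> 'v) \<Rightarrow>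
     (nat \<Rightarrow> real) \<Rightarrow> nat \<Rightarrow> 'v \<Rightarrow> 'v"
  where
  "local_truncation_error F G t n z = F (t n) (t (n - 1)) z - G (t n) (t (n - 1)) z"

(* parareal F G t u0 k n is U_n^k: first the iteration number, then the time index. *)
fun parareal ::
    "(real \<Rightarrow> real \<Rightarrow> 'v \<Rightarrow> 'v::real_normed_vector) \<Rightarrow> (real \<Rightarrow> real \<Rightarrow> 'v \<Rightarrow> 'v) \<Rightarrow>
     (nat \<Rightarrow> real) \<Rightarrow> 'v \<Rightarrow> nat \<Rightarrow> nat \<Rightarrow> 'v"
  where
  "parareal F G t u0 k 0 = u0"
| "parareal F G t u0 0 (Suc n) = G (t (Suc n)) (t n) (parareal F G t u0 0 n)"
| "parareal F G t u0 (Suc k) (Suc n) =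
     F (t (Suc n)) (t n) (parareal F G t u0 k n)
     + G (t (Suc n)) (t n) (parareal F G t u0 (Suc k) n)
     - G (t (Suc n)) (t n) (parareal F G t u0 k n)"

(* B_n^k, with the arguments k, n in the same order as in parareal *)
definition parareal_bound :: "real \<Rightarrow> real \<Rightarrow> real \<Rightarrow> nat \<Rightarrow> nat \<Rightarrow> real"
  where
  "parareal_bound \<alpha> \<beta> \<eta> k n =
     (if n \<le> k then 0
      else \<alpha> * \<beta> ^ k * (\<Sum>i = 0..n - k - 1. real ((k + i) choose k) * \<eta> ^ i))"

end

theory Submission
  imports Defs
begin

text \<open>
  Write \<open>e k n\<close> for the error of the \<open>k\<close>-th iterate at time \<open>t n\<close>. The exact solution is
  transported by \<open>F\<close>, that is, \<open>u (t (n + 1)) = F (t (n + 1)) (t n) (u (t n))\<close>; this is where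
  uniqueness for the initial value problem enters (\<open>exact_propagator_along_solution\<close>). Splitting
  \<open>F = \<tau> + G\<close> in this identity and regrouping the parareal update as
  \<open>\<tau> (U k n) + G (U (k + 1) n)\<close>, the difference of the two is an increment of \<open>\<tau>\<close> plus an
  increment of \<open>G\<close>, whence
  \<open>e (k + 1) (n + 1) \<le> \<beta> * e k n + \<eta> * e (k + 1) n\<close>.
  The starting row has only the coarse integrator, so there \<open>\<tau>\<close> is itself the defect and
  \<open>e 0 (n + 1) \<le> \<alpha> + \<eta> * e 0 n\<close>; moreover \<open>e k 0 = 0\<close>.

  The numbers \<open>parareal_bound\<close> satisfy exactly these recursions with equality: after the
  factor \<open>\<alpha> * \<beta> ^ k\<close> is removed, the recursion is Pascal's rule summed against powers of
  \<open>\<eta>\<close> (\<open>binomial_power_sum_rec\<close>). As the coefficients \<open>\<beta>\<close> and \<open>\<eta>\<close> are nonnegative, induction on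
  \<open>n\<close> gives \<open>e k n \<le> parareal_bound \<alpha> \<beta> \<eta> k n\<close>.
\<close>

lemma solves_ivp_on_subinterval:
  assumes "solves_ivp_on f a b z u" and "a \<le> c" and "d \<le> b"
  shows "solves_ivp_on f c d (u c) u"
  using assms unfolding solves_ivp_on_def
  by (auto intro!: has_vector_derivative_within_subset[where T = "{c..d}" and S = "{a..b}"])

text \<open>
  The restriction of the solution to a subinterval is a solution there, and well-posedness of the
  restarted problem makes it the only one, so the definite description picks its endpoint.
\<close>

lemma exact_propagator_along_solution:
  assumes sol: "solves_ivp_on f a b z u" and "a \<le> c" "c \<le> d" "d \<le> b"
    and wp: "well_posed_ivp_on f c d (u c)"
  shows "exact_propagator f d c (u c) = u d"
proof -
  have sub: "solves_ivp_on f c d (u c) u"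
    by (rule solves_ivp_on_subinterval[OF sol \<open>a \<le> c\<close> \<open>d \<le> b\<close>])
  have unique: "v d = u d" if "solves_ivp_on f c d (u c) v" for v
  proof -
    have "\<forall>s\<in>{c..d}. v s = u s"
      using wp sub that unfolding well_posed_ivp_on_def by blast
    then show ?thesis
      using \<open>c \<le> d\<close> by simp
  qed
  show ?thesis
    unfolding exact_propagator_def
  proof (rule the_equality)
    show "\<exists>v. solves_ivp_on f c d (u c) v \<and> v d = u d"
      using sub by blast
  qed (use unique in blast)
qed

lemma is_time_partition_mono:
  assumes "is_time_partition T M t" and "m \<le> n" and "n \<le> M"
  shows "t m \<le> t n"
  using assms(2,3)
proof (induction n rule: dec_induct)
  case base
  then show ?case by simp
next
  case (step n)
  then have "t n < t (Suc n)"
    using assms(1) by (simp add: is_time_partition_def)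
  with step show ?case by simp
qed

text \<open>
  Pascal's rule splits each coefficient of the left-hand side in two. The second half has no
  constant term, and shifting its index by one produces the factor \<open>x\<close>.
\<close>

lemma binomial_power_sum_rec:
  fixes x :: "'a::comm_semiring_1"
  shows "(\<Sum>i<m. of_nat ((Suc k + i) choose Suc k) * x ^ i) =
    (\<Sum>i<m. of_nat ((k + i) choose k) * x ^ i)
      + x * (\<Sum>i<m - 1. of_nat ((Suc k + i) choose Suc k) * x ^ i)"
proof (cases m)
  case 0
  then show ?thesis by simp
next
  case (Suc l)
  have "(\<Sum>i<m. of_nat ((k + i) choose Suc k) * x ^ i) =
      x * (\<Sum>i<m - 1. of_nat ((Suc k + i) choose Suc k) * x ^ i)"
    unfolding Suc by (subst sum.lessThan_Suc_shift)
      (simp add: sum_distrib_left mult_ac binomial_eq_0)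
  then show ?thesis
    by (simp add: distrib_right sum.distrib)
qed

text \<open>
  With truncated subtraction the case distinction in the definition disappears: the range of
  summation is empty for \<open>n \<le> k\<close>. The recursions below then need no case analysis in \<open>n\<close> and \<open>k\<close>.
\<close>

lemma parareal_bound_eq_sum_lessThan:
  "parareal_bound \<alpha> \<beta> \<eta> k n =
    \<alpha> * \<beta> ^ k * (\<Sum>i<n - k. real ((k + i) choose k) * \<eta> ^ i)"
proof (cases "n \<le> k")
  case True
  then show ?thesis by (simp add: parareal_bound_def)
next
  case False
  then have "{0..n - k - 1} = {..<n - k}" by auto
  with False show ?thesis by (simp add: parareal_bound_def)
qed

lemma parareal_bound_at_0 [simp]: "parareal_bound \<alpha> \<beta> \<eta> k 0 = 0"
  by (simp add: parareal_bound_def)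

lemma parareal_bound_0_Suc:
  "parareal_bound \<alpha> \<beta> \<eta> 0 (Suc n) = \<alpha> + \<eta> * parareal_bound \<alpha> \<beta> \<eta> 0 n"
  by (simp add: parareal_bound_eq_sum_lessThan sum.lessThan_Suc_shift sum_distrib_left
      algebra_simps del: sum.lessThan_Suc)

lemma parareal_bound_Suc_Suc:
  "parareal_bound \<alpha> \<beta> \<eta> (Suc k) (Suc n) =
    \<beta> * parareal_bound \<alpha> \<beta> \<eta> k n + \<eta> * parareal_bound \<alpha> \<beta> \<eta> (Suc k) n"
proof -
  have "n - k - 1 = n - Suc k" by simp
  note rec = binomial_power_sum_rec[of k \<eta> "n - k", unfolded this]
  show ?thesis
    unfolding parareal_bound_eq_sum_lessThan diff_Suc_Suc rec power_Suc
    by (simp only: distrib_left mult_ac)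
qed

text \<open>
  A comparison principle: the bound dominates every double sequence that satisfies its recursions
  as inequalities, because nonnegative coefficients make the right-hand sides monotone.
\<close>

lemma le_parareal_bound:
  fixes e :: "nat \<Rightarrow> nat \<Rightarrow> real"
  assumes nonneg: "0 \<le> \<beta>" "0 \<le> \<eta>"
    and init: "\<And>k. e k 0 \<le> 0"
    and coarse: "\<And>n. n < M \<Longrightarrow> e 0 (Suc n) \<le> \<alpha> + \<eta> * e 0 n"
    and correction: "\<And>k n. n < M \<Longrightarrow> e (Suc k) (Suc n) \<le> \<beta> * e k n + \<eta> * e (Suc k) n"
  shows "n \<le> M \<Longrightarrow> e k n \<le> parareal_bound \<alpha> \<beta> \<eta> k n"
proof (induction n arbitrary: k)
  case 0
  then show ?case using init by simp
next
  case (Suc n)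
  then have n: "n < M" and IH: "\<And>k. e k n \<le> parareal_bound \<alpha> \<beta> \<eta> k n"
    by simp_all
  show ?case
  proof (cases k)
    case 0
    have "\<eta> * e 0 n \<le> \<eta> * parareal_bound \<alpha> \<beta> \<eta> 0 n"
      using IH nonneg by (intro mult_left_mono)
    with coarse[OF n] 0 show ?thesis
      by (simp add: parareal_bound_0_Suc)
  next
    case (Suc j)
    have "\<beta> * e j n + \<eta> * e (Suc j) n
        \<le> \<beta> * parareal_bound \<alpha> \<beta> \<eta> j n + \<eta> * parareal_bound \<alpha> \<beta> \<eta> (Suc j) n"
      using IH nonneg by (intro add_mono mult_left_mono)
    with correction[OF n, of j] Suc show ?thesis
      by (simp add: parareal_bound_Suc_Suc)
  qed
qed

text \<open>
  The convergence estimate in discrete form: the exact solution matters only through the values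
  \<open>v n\<close> it takes at the grid points, which form an orbit of the fine propagator.
\<close>

lemma parareal_error_le:
  fixes F G :: "real \<Rightarrow> real \<Rightarrow> 'v \<Rightarrow> 'v::real_normed_vector"
  assumes nonneg: "0 \<le> \<beta>" "0 \<le> \<eta>"
    and orbit: "v 0 = u0" "\<And>n. n < M \<Longrightarrow> v (Suc n) = F (t (Suc n)) (t n) (v n)"
    and trunc: "\<And>n z. n < M \<Longrightarrow> norm (local_truncation_error F G t (Suc n) z) \<le> \<alpha>"
    and trunc_lipschitz: "\<And>n y z. n < M \<Longrightarrow>
      norm (local_truncation_error F G t (Suc n) y - local_truncation_error F G t (Suc n) z)
        \<le> \<beta> * norm (y - z)"
    and coarse_lipschitz: "\<And>n y z. n < M \<Longrightarrow>
      norm (G (t (Suc n)) (t n) y - G (t (Suc n)) (t n) z) \<le> \<eta> * norm (y - z)"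
    and "n \<le> M"
  shows "norm (parareal F G t u0 k n - v n) \<le> parareal_bound \<alpha> \<beta> \<eta> k n"
proof (rule le_parareal_bound[where e = "\<lambda>k n. norm (parareal F G t u0 k n - v n)"])
  fix n assume n: "n < M"
  let ?U = "\<lambda>k. parareal F G t u0 k n"
  let ?\<tau> = "local_truncation_error F G t (Suc n)"
  let ?G = "G (t (Suc n)) (t n)"
  have split_coarse: "parareal F G t u0 0 (Suc n) - v (Suc n) = (?G (?U 0) - ?G (v n)) - ?\<tau> (v n)"
    using orbit(2)[OF n] by (simp add: local_truncation_error_def)
  show "norm (parareal F G t u0 0 (Suc n) - v (Suc n)) \<le> \<alpha> + \<eta> * norm (?U 0 - v n)"
    unfolding split_coarse
    using norm_triangle_ineq4[of "?G (?U 0) - ?G (v n)" "?\<tau> (v n)"]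
      trunc[OF n, of "v n"] coarse_lipschitz[OF n, of "?U 0" "v n"] by linarith
  fix k
  have split_correction: "parareal F G t u0 (Suc k) (Suc n) - v (Suc n) =
      (?\<tau> (?U k) - ?\<tau> (v n)) + (?G (?U (Suc k)) - ?G (v n))"
    using orbit(2)[OF n] by (simp add: local_truncation_error_def)
  show "norm (parareal F G t u0 (Suc k) (Suc n) - v (Suc n))
      \<le> \<beta> * norm (?U k - v n) + \<eta> * norm (?U (Suc k) - v n)"
    unfolding split_correction
    using norm_triangle_ineq[of "?\<tau> (?U k) - ?\<tau> (v n)" "?G (?U (Suc k)) - ?G (v n)"]
      trunc_lipschitz[OF n, of "?U k" "v n"]
      coarse_lipschitz[OF n, of "?U (Suc k)" "v n"] by linarith
qed (use nonneg orbit(1) \<open>n \<le> M\<close> in simp_all)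

theorem theorem4p1:
  fixes f :: "real ^ 'm \<Rightarrow> real ^ 'm"
    and F G :: "real \<Rightarrow> real \<Rightarrow> real ^ 'm \<Rightarrow> real ^ 'm"
    and u :: "real \<Rightarrow> real ^ 'm"
    and u0 :: "real ^ 'm"
    and t :: "nat \<Rightarrow> real"
    and T \<alpha> \<beta> \<eta> :: real
    and M :: nat
  assumes partition: "is_time_partition T M t"
    and solution: "solves_ivp_on f 0 T u0 u"
    and well_posed: "\<And>n z. n \<in> {1..M} \<Longrightarrow> well_posed_ivp_on f (t (n - 1)) (t n) z"
    and exact: "\<And>n z. n \<in> {1..M} \<Longrightarrow>
      F (t n) (t (n - 1)) z = exact_propagator f (t n) (t (n - 1)) z"
    and constants: "0 < \<alpha>" "0 < \<beta>" "0 < \<eta>" "\<eta> < 1"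
    and truncation_bound: "\<And>n z. n \<in> {1..M} \<Longrightarrow>
      norm (local_truncation_error F G t n z) \<le> \<alpha>"
    and truncation_lipschitz: "\<And>n y z. n \<in> {1..M} \<Longrightarrow>
      norm (local_truncation_error F G t n y - local_truncation_error F G t n z)
        \<le> \<beta> * norm (y - z)"
    and contraction: "\<And>n y z. n \<in> {1..M} \<Longrightarrow>
      max (norm (F (t n) (t (n - 1)) y - F (t n) (t (n - 1)) z))
          (norm (G (t n) (t (n - 1)) y - G (t n) (t (n - 1)) z))
        \<le> \<eta> * norm (y - z)"
  shows "\<forall>k n. n \<le> M \<longrightarrow>
    norm (parareal F G t u0 k n - u (t n)) \<le> parareal_bound \<alpha> \<beta> \<eta> k n"
proof (intro allI impI)
  fix k n assume "n \<le> M"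
  have t: "t 0 = 0" "t M = T"
    using partition by (simp_all add: is_time_partition_def)
  show "norm (parareal F G t u0 k n - u (t n)) \<le> parareal_bound \<alpha> \<beta> \<eta> k n"
  proof (rule parareal_error_le[where M = M and v = "\<lambda>n. u (t n)"])
    show "u (t 0) = u0"
      using solution t by (simp add: solves_ivp_on_def)
  next
    fix n assume n: "n < M"
    have "0 \<le> t n" "t n \<le> t (Suc n)" "t (Suc n) \<le> T"
      using is_time_partition_mono[OF partition, of 0 n]
        is_time_partition_mono[OF partition, of n "Suc n"]
        is_time_partition_mono[OF partition, of "Suc n" M] n t by simp_all
    then have "exact_propagator f (t (Suc n)) (t n) (u (t n)) = u (t (Suc n))"
      using exact_propagator_along_solution[OF solution] well_posed[of "Suc n"] n by simp
    then show "u (t (Suc n)) = F (t (Suc n)) (t n) (u (t n))"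
      using exact[of "Suc n"] n by simp
  next
    fix n y z assume "n < M"
    then show "norm (G (t (Suc n)) (t n) y - G (t (Suc n)) (t n) z) \<le> \<eta> * norm (y - z)"
      using contraction[of "Suc n" y z] by simp
  qed (use constants truncation_bound truncation_lipschitz \<open>n \<le> M\<close> in simp_all)
qed

end
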